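(* Let $n\ge 2$ be an integer. For each natural number $N$, there exist a finite field $\mathbb{F}$ and matrices $A,B\in \mathrm{M}_n(\mathbb{F})$ such that some product in $A,B$ equals the zero matrix $O$ (so that the minimal length of a product in $A,B$ equal to $O$ exists), and this minimal length is greater than $N$.
   Context: $\mathrm{M}_n(\mathbb{F})$ denotes the ring of $n\times n$ matrices over the field $\mathbb{F}$, and $O$ denotes the zero matrix. For matrices $A_1,\dots,A_k\in \mathrm{M}_n(\mathbb{F})$, a product in $A_1,\dots,A_k$ of length $l$ (with $l\ge 1$) is a product $A_{i_1}A_{i_2}\cdots A_{i_l}$ with indices $1\le i_1,\dots,i_l\le k$ not necessarily distinct. *)

theory Defs
  imports "Jordan_Normal_Form.Matrix" "HOL-Algebra.Ring"
begin

text \<open>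
  The ring \<open>M\<^sub>n(R)\<close> for a HOL-Algebra ring \<open>R\<close>. The type \<^typ>\<open>'a mat\<close> serves only as a container
  for the entries: the operations are those of the record \<open>R\<close>, not the type class operations
  of \<^typ>\<open>'a\<close> (so the type class versions \<open>A + B\<close>, \<open>A * B\<close>, \<open>1\<^sub>m n\<close>, \<open>0\<^sub>m n n\<close> are not used).
  Rows and columns are indexed from 0.
\<close>

definition matrix_ring :: "('a, 'b) ring_scheme \<Rightarrow> nat \<Rightarrow> 'a mat ring" where
  "matrix_ring R n =
    \<lparr>carrier = {A \<in> carrier_mat n n. \<forall>i<n. \<forall>j<n. A $$ (i, j) \<in> carrier R},
     mult = (\<lambda>A B. mat n n (\<lambda>(i, j). \<Oplus>\<^bsub>R\<^esub>k\<in>{..<n}. A $$ (i, k) \<otimes>\<^bsub>R\<^esub> B $$ (k, j))),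
     one = mat n n (\<lambda>(i, j). if i = j then \<one>\<^bsub>R\<^esub> else \<zero>\<^bsub>R\<^esub>),
     zero = mat n n (\<lambda>(i, j). \<zero>\<^bsub>R\<^esub>),
     add = (\<lambda>A B. mat n n (\<lambda>(i, j). A $$ (i, j) \<oplus>\<^bsub>R\<^esub> B $$ (i, j)))\<rparr>"

text \<open>
  \<open>P\<close> is a product of length \<open>l \<ge> 1\<close> in the list \<open>As = [A\<^sub>0, \<dots>, A\<^sub>k\<^sub>-\<^sub>1]\<close>; the list \<open>is\<close> of indices
  may contain repetitions and need not use every index.
\<close>

definition is_product_of_length ::
    "('a, 'b) monoid_scheme \<Rightarrow> 'a list \<Rightarrow> nat \<Rightarrow> 'a \<Rightarrow> bool" where
  "is_product_of_length M As l P \<longleftrightarrow>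
    l \<ge> 1 \<and>
    (\<exists>is. length is = l \<and> set is \<subseteq> {..<length As} \<and>
          P = foldr (\<lambda>i X. As ! i \<otimes>\<^bsub>M\<^esub> X) is \<one>\<^bsub>M\<^esub>)"

text \<open>Only meaningful if some product in \<open>As\<close> is zero; otherwise the value is unspecified.\<close>

definition min_zero_product_length :: "('a, 'b) ring_scheme \<Rightarrow> 'a list \<Rightarrow> nat" where
  "min_zero_product_length M As = (LEAST l. is_product_of_length M As l \<zero>\<^bsub>M\<^esub>)"

text \<open>
  HOL has no quantification over types inside a formula, so a finite field is a HOL-Algebra
  structure \<open>F\<close> with \<open>field F\<close> and \<open>finite (carrier F)\<close>. Existence of a finite field is expressed by
  existence of a record on \<^typ>\<open>int\<close>; the choice of the type is immaterial,
  because \<^typ>\<open>int\<close> is infinite and hence contains an isomorphic copy of every finite field.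
  The record's operations are arbitrary and unrelated to integer arithmetic.
\<close>

end

theory Submission
  imports Defs "HOL-Number_Theory.Residues"
begin

text \<open>
  Take \<open>\<int>/p\<close> for a prime \<open>p > N + 1\<close>, let \<open>A\<close> be the rank one matrix \<open>(e\<^sub>0 + e\<^sub>1) e\<^sub>0\<^sup>T\<close> and
  let \<open>B = 1 + e\<^sub>0 e\<^sub>1\<^sup>T\<close>. Multiplication by \<open>A\<close> sends a vector beginning with \<open>(x, y)\<close> to \<open>(x, x, 0, \<dots>)\<close>,
  and \<open>B\<close> turns the beginning \<open>(x, y)\<close> into \<open>(x + y, y)\<close>. Hence \<open>A B\<^sup>p\<^sup>-\<^sup>1 A = 0\<close>, whereas a short
  product sends \<open>e\<^sub>0\<close> to a vector beginning with \<open>(x, 0)\<close> or \<open>(m y, y)\<close>, where \<open>x \<noteq> 0\<close>, \<open>y \<noteq> 0\<close> and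
  \<open>m\<close> exceeds the length of the product by at most one, so that \<open>m\<close> cannot reach \<open>p\<close>.
\<close>

definition column_matrix :: "('a, 'b) ring_scheme \<Rightarrow> nat \<Rightarrow> 'a mat" where
  "column_matrix R n = mat n n (\<lambda>(i, k). if k = 0 \<and> i < 2 then \<one>\<^bsub>R\<^esub> else \<zero>\<^bsub>R\<^esub>)"

definition transvection_matrix :: "('a, 'b) ring_scheme \<Rightarrow> nat \<Rightarrow> 'a mat" where
  "transvection_matrix R n =
    mat n n (\<lambda>(i, k). if i = k \<or> i = 0 \<and> k = 1 then \<one>\<^bsub>R\<^esub> else \<zero>\<^bsub>R\<^esub>)"

lemma matrix_ring_entry_closed:
  assumes "X \<in> carrier (matrix_ring R n)" "i < n" "j < n"
  shows "X $$ (i, j) \<in> carrier R"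
  using assms by (simp add: matrix_ring_def)

context ring
begin

lemma column_matrix_carrier: "column_matrix R n \<in> carrier (matrix_ring R n)"
  by (auto simp: column_matrix_def matrix_ring_def)

lemma transvection_matrix_carrier: "transvection_matrix R n \<in> carrier (matrix_ring R n)"
  by (auto simp: transvection_matrix_def matrix_ring_def)

lemma matrix_ring_one_closed: "\<one>\<^bsub>matrix_ring R n\<^esub> \<in> carrier (matrix_ring R n)"
  by (auto simp: matrix_ring_def)

lemma matrix_ring_mult_closed:
  assumes "X \<in> carrier (matrix_ring R n)" "Y \<in> carrier (matrix_ring R n)"
  shows "X \<otimes>\<^bsub>matrix_ring R n\<^esub> Y \<in> carrier (matrix_ring R n)"
  using assms by (auto simp: matrix_ring_def intro!: finsum_closed)

lemma column_matrix_mult_entry: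
  assumes "X \<in> carrier (matrix_ring R n)" "i < n" "j < n"
  shows "(column_matrix R n \<otimes>\<^bsub>matrix_ring R n\<^esub> X) $$ (i, j) = (if i < 2 then X $$ (0, j) else \<zero>)"
proof -
  note X = matrix_ring_entry_closed[OF assms(1) _ assms(3)]
  have "(column_matrix R n \<otimes>\<^bsub>matrix_ring R n\<^esub> X) $$ (i, j)
      = (\<Oplus>k\<in>{..<n}. column_matrix R n $$ (i, k) \<otimes> X $$ (k, j))"
    using assms by (simp add: matrix_ring_def)
  \<comment> \<open>The summand keeps \<open>X $$ (k, j)\<close> and the test \<open>0 = k\<close>
    so that it has the shape required by \<open>finsum_singleton\<close>.\<close>
  also have "\<dots> = (\<Oplus>k\<in>{..<n}. if 0 = k then (if i < 2 then X $$ (k, j) else \<zero>) else \<zero>)"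
    by (rule finsum_cong') (use assms X in \<open>auto simp: column_matrix_def\<close>)
  also have "\<dots> = (if i < 2 then X $$ (0, j) else \<zero>)"
    by (rule finsum_singleton) (use assms X in auto)
  finally show ?thesis .
qed

lemma transvection_matrix_mult_entry:
  assumes "X \<in> carrier (matrix_ring R n)" "2 \<le> n" "i < n" "j < n"
  shows "(transvection_matrix R n \<otimes>\<^bsub>matrix_ring R n\<^esub> X) $$ (i, j) =
    (if i = 0 then X $$ (0, j) \<oplus> X $$ (1, j) else X $$ (i, j))"
proof -
  note X = matrix_ring_entry_closed[OF assms(1) _ assms(4)]
  \<comment> \<open>Row i of the transvection is a unit row, plus a second one at position 1 when i
    = 0. Splitting along these two gives sums with a single nonzero term each.\<close>
  let ?f = "\<lambda>k. if i = k then X $$ (k, j) else \<zero>"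
  let ?g = "\<lambda>k. if 1 = k then (if i = 0 then X $$ (k, j) else \<zero>) else \<zero>"
  have "(transvection_matrix R n \<otimes>\<^bsub>matrix_ring R n\<^esub> X) $$ (i, j)
      = (\<Oplus>k\<in>{..<n}. transvection_matrix R n $$ (i, k) \<otimes> X $$ (k, j))"
    using assms by (simp add: matrix_ring_def)
  also have "\<dots> = (\<Oplus>k\<in>{..<n}. ?f k \<oplus> ?g k)"
    by (rule finsum_cong') (use assms X in \<open>auto simp: transvection_matrix_def\<close>)
  also have "\<dots> = (\<Oplus>k\<in>{..<n}. ?f k) \<oplus> (\<Oplus>k\<in>{..<n}. ?g k)"
    by (rule finsum_addf) (use X in auto)
  also have "(\<Oplus>k\<in>{..<n}. ?f k) = X $$ (i, j)"
    by (rule finsum_singleton) (use assms X in auto)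
  also have "(\<Oplus>k\<in>{..<n}. ?g k) = (if i = 0 then X $$ (1, j) else \<zero>)"
    by (rule finsum_singleton) (use assms X in auto)
  finally show ?thesis
    using X assms by auto
qed

end

context residues_prime
begin

abbreviation "A n \<equiv> column_matrix R n"
abbreviation "B n \<equiv> transvection_matrix R n"
text \<open>Index 0 stands for \<open>A n\<close> and index 1 for \<open>B n\<close>. The body is
  the fold of \<open>is_product_of_length\<close>, so facts about words apply to that predicate
  directly.\<close>

abbreviation "word_product n is \<equiv>
  foldr (\<lambda>i X. [A n, B n] ! i \<otimes>\<^bsub>matrix_ring R n\<^esub> X) is \<one>\<^bsub>matrix_ring R n\<^esub>"

lemma word_product_carrier:
  "set is \<subseteq> {..<2} \<Longrightarrow> word_product n is \<in> carrier (matrix_ring R n)"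
  by (induction "is")
    (auto simp: less_2_cases_iff matrix_ring_one_closed column_matrix_carrier
      transvection_matrix_carrier intro!: matrix_ring_mult_closed)

text \<open>A new head letter multiplies on the left. Modulo p, \<open>A n\<close> resets the ratio
  x/y to 1; \<open>B n\<close> raises it by 1 if y is nonzero and fixes x if y vanishes. The ratio
  starts too low to reach p within the allowed length, so x never vanishes.\<close>

lemma word_product_first_column:
  fixes "is" :: "nat list"
  assumes "2 \<le> n" "set is \<subseteq> {..<2}" "length is + 1 < p"
  defines "x \<equiv> word_product n is $$ (0, 0)" and "y \<equiv> word_product n is $$ (1, 0)"
  shows "\<not> int p dvd x \<and>
    (int p dvd y \<or> (\<exists>m. 1 \<le> m \<and> m \<le> length is + 1 \<and> [x = int m * y] (mod int p)))"
  using assms(2,3) unfolding x_def y_def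
proof (induction "is")
  case Nil
  show ?case
    using assms(1) prime_gt_1_nat[OF p_prime] by (simp add: matrix_ring_def res_one_eq res_zero_eq)
next
  case (Cons i "is")
  let ?x = "word_product n is $$ (0, 0)" and ?y = "word_product n is $$ (1, 0)"
  have carr: "word_product n is \<in> carrier (matrix_ring R n)"
    using Cons.prems by (intro word_product_carrier) auto
  have IH: "\<not> int p dvd ?x"
    "int p dvd ?y \<or> (\<exists>m. 1 \<le> m \<and> m \<le> length is + 1 \<and> [?x = int m * ?y] (mod int p))"
    using Cons by auto
  consider "i = 0" | "i = 1" using Cons.prems by (auto simp: less_2_cases_iff)
  then show ?case
  proof cases
    case 1
    then have "word_product n (i # is) $$ (0, 0) = ?x" "word_product n (i # is) $$ (1, 0) = ?x"
      using assms(1) column_matrix_mult_entry[OF carr] by auto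
    moreover have "[?x = int 1 * ?x] (mod int p)" by simp
    ultimately show ?thesis using IH(1) by (metis le_add2 le_refl)
  next
    case 2
    then have eq: "word_product n (i # is) $$ (0, 0) = (?x + ?y) mod int p"
      "word_product n (i # is) $$ (1, 0) = ?y"
      using assms(1) transvection_matrix_mult_entry[OF carr] by (auto simp: res_add_eq)
    show ?thesis
    proof (cases "int p dvd ?y")
      case True
      then have "\<not> int p dvd ?x + ?y" using IH(1) by (simp add: dvd_add_left_iff)
      with True show ?thesis unfolding eq by (simp add: dvd_mod_iff)
    next
      case False
      then obtain m where m: "m \<le> length is + 1" "[?x = int m * ?y] (mod int p)"
        using IH(2) by auto
      have cong: "[(?x + ?y) mod int p = int (Suc m) * ?y] (mod int p)"
        using cong_add[OF m(2) cong_refl[of ?y]] by (simp add: cong_def algebra_simps)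
      \<comment> \<open>Here \<open>Suc m\<close> is at most the length of the extended word plus 1,
        hence positive and below p.\<close>
      have "\<not> int p dvd int (Suc m)"
        using m(1) Cons.prems(2) by (auto dest!: dvd_imp_le simp flip: of_nat_Suc)
      then have "\<not> int p dvd int (Suc m) * ?y"
        using False p_prime by (simp add: prime_dvd_mult_iff)
      then have "\<not> int p dvd (?x + ?y) mod int p"
        using cong cong_dvd_iff by blast
      then show ?thesis unfolding eq using cong m(1) by (auto intro!: exI[of _ "Suc m"])
    qed
  qed
qed

lemma word_product_nonzero:
  assumes "2 \<le> n" "set is \<subseteq> {..<2}" "length is + 1 < p"
  shows "word_product n is \<noteq> \<zero>\<^bsub>matrix_ring R n\<^esub>"
proof
  assume "word_product n is = \<zero>\<^bsub>matrix_ring R n\<^esub>"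
  then have "word_product n is $$ (0, 0) = 0"
    using assms(1) by (simp add: matrix_ring_def res_zero_eq)
  then show False using word_product_first_column[OF assms] by simp
qed

text \<open>Each factor \<open>B n\<close> adds row 1 to row 0, and row 1 stays the first unit row.
  At k = p - 1 row 0 vanishes. All columns j are covered because the final product must vanish as a
  whole matrix.\<close>

lemma word_product_power_column:
  assumes "2 \<le> n" "j < n"
  defines "X k \<equiv> word_product n (replicate k 1 @ [0])"
  shows "X k $$ (0, j) = (if j = 0 then int (k + 1) mod int p else 0) \<and>
    X k $$ (1, j) = (if j = 0 then 1 else 0)"
proof (induction k)
  case 0
  show ?case
    unfolding X_def using assms(1,2) p_prime prime_gt_1_nat[OF p_prime]
    by (simp add: column_matrix_mult_entry[OF matrix_ring_one_closed])
      (auto simp: matrix_ring_def res_one_eq res_zero_eq)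
next
  case (Suc k)
  have "X k \<in> carrier (matrix_ring R n)"
    unfolding X_def by (rule word_product_carrier) auto
  then show ?case
    using assms(1,2) Suc transvection_matrix_mult_entry[of "X k" n]
    by (auto simp: X_def res_add_eq mod_simps algebra_simps)
qed

lemma word_product_zero:
  assumes "2 \<le> n"
  shows "word_product n (0 # replicate (p - 1) 1 @ [0]) = \<zero>\<^bsub>matrix_ring R n\<^esub>" (is "?P = ?Z")
proof (rule eq_matI)
  let ?X = "word_product n (replicate (p - 1) 1 @ [0])"
  have X: "?X \<in> carrier (matrix_ring R n)"
    by (rule word_product_carrier) auto
  have "?P \<in> carrier (matrix_ring R n)"
    by (rule word_product_carrier) auto
  then show "dim_row ?P = dim_row ?Z" "dim_col ?P = dim_col ?Z"
    by (auto simp: matrix_ring_def)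
  fix i j assume "i < dim_row ?Z" "j < dim_col ?Z"
  then have ij: "i < n" "j < n" by (auto simp: matrix_ring_def)
  \<comment> \<open>Left multiplication by \<open>A n\<close> sees only row 0 of \<open>?X\<close>,
    so its vanishing suffices.\<close>
  have "?X $$ (0, j) = 0"
    using word_product_power_column[OF assms ij(2), of "p - 1"] prime_gt_0_nat[OF p_prime] by auto
  then have "?P $$ (i, j) = 0"
    using column_matrix_mult_entry[OF X ij] by (simp add: res_zero_eq)
  then show "?P $$ (i, j) = ?Z $$ (i, j)"
    using ij by (simp add: matrix_ring_def res_zero_eq)
qed

lemma min_zero_product_length_ge:
  assumes "2 \<le> n"
  shows "\<exists>l. is_product_of_length (matrix_ring R n) [A n, B n] l \<zero>\<^bsub>matrix_ring R n\<^esub>"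
    and "p \<le> min_zero_product_length (matrix_ring R n) [A n, B n] + 1"
proof -
  let ?P = "\<lambda>l. is_product_of_length (matrix_ring R n) [A n, B n] l \<zero>\<^bsub>matrix_ring R n\<^esub>"
  \<comment> \<open>The length counts p - 1 factors \<open>B n\<close> and the two outer factors
    \<open>A n\<close>.\<close>
  have "?P (p + 1)"
    unfolding is_product_of_length_def using word_product_zero[OF assms] prime_gt_0_nat[OF p_prime]
    by (intro conjI exI[of _ "0 # replicate (p - 1) 1 @ [0]"]) auto
  then show ex: "\<exists>l. ?P l" ..
  have "p \<le> l + 1" if "?P l" for l
    using that word_product_nonzero[OF assms]
    unfolding is_product_of_length_def by (force simp: numeral_2_eq_2 not_less[symmetric])
  then show "p \<le> min_zero_product_length (matrix_ring R n) [A n, B n] + 1"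
    unfolding min_zero_product_length_def using LeastI_ex[OF ex] by blast
qed

end

theorem theorem4:
  fixes n :: nat
  assumes "n \<ge> 2"
  shows "\<forall>N :: nat. \<exists>F :: int ring.
    field F \<and> finite (carrier F) \<and>
    (\<exists>A \<in> carrier (matrix_ring F n). \<exists>B \<in> carrier (matrix_ring F n).
       (\<exists>l. is_product_of_length (matrix_ring F n) [A, B] l \<zero>\<^bsub>matrix_ring F n\<^esub>) \<and>
       min_zero_product_length (matrix_ring F n) [A, B] > N)"
proof
  fix N :: nat
  \<comment> \<open>The minimal length is at least p - 1, which must exceed N.\<close>
  obtain p :: nat where p: "prime p" "p > N + 1"
    using bigger_prime by blast
  let ?F = "residue_ring (int p)"
  interpret residues_prime p ?F
    using p(1) by unfold_locales auto
  have "min_zero_product_length (matrix_ring ?F n) [column_matrix ?F n, transvection_matrix ?F n] > N"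
    using min_zero_product_length_ge(2)[OF assms] p(2) by linarith
  then show "\<exists>F :: int ring. field F \<and> finite (carrier F) \<and>
    (\<exists>A \<in> carrier (matrix_ring F n). \<exists>B \<in> carrier (matrix_ring F n).
       (\<exists>l. is_product_of_length (matrix_ring F n) [A, B] l \<zero>\<^bsub>matrix_ring F n\<^esub>) \<and>
       min_zero_product_length (matrix_ring F n) [A, B] > N)"
    using is_field finite min_zero_product_length_ge(1)[OF assms]
      column_matrix_carrier transvection_matrix_carrier by blast
qed

end
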